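(* Let $a<b$ be real numbers and $c\in(0,\pi)$ with $ac+b(\pi-c)=0$, let $q(x)=a$ for $x\in[0,c]$, $q(x)=b$ for $x\in(c,\pi]$, and let $M=\max\{|a|,b\}$. Let $n$ be a positive integer such that $M<(2n-1)/2$ if $n>1$, and $M\le 1/2$ if $n=1$. Put $I_n=[n^2-M,n^2+M]$. Then a number $\lambda\in I_n$ is an eigenvalue of $L(q)$ if and only if it is a root of the equation \[ \lambda-n^{2}+C_{2n}-\sum_{k=1}^{\infty}a_{k}(\lambda)=0 . \]
   Context: $L(q)$ is the operator in $L_2[0,\pi]$ generated by $-y''+q(x)y$ with the boundary conditions $y(0)=y(\pi)=0$. For $k\in\mathbb{Z}$, $C_k=\frac{1}{\pi}\int_0^\pi q(x)\cos kx\,dx$; for this potential $C_0=0$ and $C_k=\frac{a-b}{\pi k}\sin kc$ for $k\neq0$, $C_{-k}=C_k$. For fixed $n$ and $k\ge1$, \[ a_k(\lambda)=\sum\frac{C_{n_1}C_{n_2}\cdots C_{n_k}\bigl(C_{n_1+\cdots+n_k}-C_{n_1+\cdots+n_k+2n}\bigr)}{\prod_{j=1}^{k}\bigl[\lambda-(n+n_1+\cdots+n_j)^2\bigr]}, \] where the sum is over all $(n_1,\dots,n_k)\in\mathbb{Z}^k$ such that $n_1+\cdots+n_j\notin\{0,-2n\}$ for $j=1,\dots,k$. *)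

theory Defs
  imports "HOL-Analysis.Analysis"
begin

definition step_pot :: "real \<Rightarrow> real \<Rightarrow> real \<Rightarrow> real \<Rightarrow> real" where
  "step_pot a b c x = (if x \<le> c then a else b)"

definition Ccoef :: "(real \<Rightarrow> real) \<Rightarrow> int \<Rightarrow> real" where
  "Ccoef q k = (1 / pi) * integral {0..pi} (\<lambda>x. q x * cos (real_of_int k * x))"

text \<open>lambda is an eigenvalue of the Dirichlet operator L(q) generated by -y'' + q y
  on [0,pi] with y(0) = y(pi) = 0: there is a nonzero y in the domain
  (y in C^1[0,pi], y' piecewise differentiable, i.e. differentiable off a finite set)
  with -y'' + q y = lambda y.\<close>
definition is_eigenvalue_L :: "(real \<Rightarrow> real) \<Rightarrow> real \<Rightarrow> bool" where
  "is_eigenvalue_L q lam \<longleftrightarrow>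
     (\<exists>y y' :: real \<Rightarrow> real.
        y 0 = 0 \<and> y pi = 0 \<and> (\<exists>x\<in>{0..pi}. y x \<noteq> 0) \<and>
        (\<forall>x\<in>{0..pi}. (y has_real_derivative y' x) (at x within {0..pi})) \<and>
        continuous_on {0..pi} y' \<and>
        (\<exists>S. finite S \<and> (\<forall>x\<in>{0..pi} - S.
            (y' has_real_derivative ((q x - lam) * y x)) (at x within {0..pi}))))"

definition idx_set :: "nat \<Rightarrow> nat \<Rightarrow> int list set" where
  "idx_set n k = {ns. length ns = k \<and>
      (\<forall>j\<in>{1..k}. sum_list (take j ns) \<noteq> 0 \<and> sum_list (take j ns) \<noteq> - 2 * int n)}"

definition a_term :: "(int \<Rightarrow> real) \<Rightarrow> nat \<Rightarrow> real \<Rightarrow> int list \<Rightarrow> real" where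
  "a_term C n lam ns =
     (\<Prod>j\<leftarrow>ns. C j) * (C (sum_list ns) - C (sum_list ns + 2 * int n)) /
     (\<Prod>j=1..length ns. (lam - (of_int (int n + sum_list (take j ns)))\<^sup>2))"

definition a_coef :: "(int \<Rightarrow> real) \<Rightarrow> nat \<Rightarrow> nat \<Rightarrow> real \<Rightarrow> real" where
  "a_coef C n k lam = (\<Sum>\<^sub>\<infinity> ns \<in> idx_set n k. a_term C n lam ns)"

end

theory Submission
  imports Defs
begin

text \<open>
  Let \<open>G\<close> be the inverse of \<open>\<lambda> + d\<^sup>2/dx\<^sup>2\<close> with Dirichlet conditions on the orthogonal complement
  of \<open>sin n x\<close>. Every \<open>m\<^sup>2\<close> with \<open>m \<ge> 1\<close>, \<open>m \<noteq> n\<close> has distance at least some \<open>\<delta> > M\<close> from \<open>\<lambda>\<close>, so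
  Bessel's inequality and \<open>\<bar>q\<bar> \<le> M\<close> show that \<open>G q\<close> is a contraction with factor \<open>M / \<delta>\<close> in the
  mean square norm. Hence every eigenfunction is a multiple of \<open>y = sin n x + (\<Sum>k. (G q)\<^bsup>k+1\<^esup> sin n x)\<close>,
  and \<open>y\<close> is one if and only if its \<open>n\<close>-th sine coefficient satisfies
  \<open>\<lambda> - n\<^sup>2 = 2/\<pi> \<integral> q y sin n x\<close>. The product \<open>q sin m x\<close> is the sum of \<open>C\<^sub>k sin ((m + k) x)\<close> over all
  integers \<open>k\<close>, and expanding the Neumann series with it turns the right-hand side
  into \<open>- C\<^sub>2\<^sub>n + (\<Sum>k. a\<^sub>k(\<lambda>))\<close>. The series for \<open>a\<^sub>k\<close> converges absolutely because the \<open>C\<^sub>j\<close> are bounded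
  and the denominators grow quadratically in the partial sums.
\<close>

section \<open>Bounded measurable functions and sine coefficients\<close>

text \<open>This class contains the step potential and all continuous functions and is closed under
  products, so every product formed below is integrable.\<close>

definition bdd_meas :: "(real \<Rightarrow> real) \<Rightarrow> bool" where
  "bdd_meas f \<longleftrightarrow> f \<in> borel_measurable (lebesgue_on {0..pi}) \<and> bounded (f ` {0..pi})"

definition ip :: "(real \<Rightarrow> real) \<Rightarrow> (real \<Rightarrow> real) \<Rightarrow> real" where
  "ip f g = integral {0..pi} (\<lambda>x. f x * g x)"

definition sine :: "int \<Rightarrow> real \<Rightarrow> real" where
  "sine m x = sin (of_int m * x)"

lemma bdd_meas_bound:
  assumes "bdd_meas f"
  obtains B where "B \<ge> 0" "\<And>x. x \<in> {0..pi} \<Longrightarrow> \<bar>f x\<bar> \<le> B"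
proof -
  obtain B where B: "\<forall>y\<in>f ` {0..pi}. norm y \<le> B"
    using assms by (auto simp: bdd_meas_def bounded_iff)
  show thesis by (rule that[of "max B 0"]) (use B in \<open>auto simp: le_max_iff_disj\<close>)
qed

lemma bdd_measI:
  assumes "f \<in> borel_measurable (lebesgue_on {0..pi})" "\<And>x. x \<in> {0..pi} \<Longrightarrow> \<bar>f x\<bar> \<le> B"
  shows "bdd_meas f"
  using assms unfolding bdd_meas_def bounded_iff by (auto intro!: exI[of _ B])

lemma bdd_meas_continuous: "continuous_on {0..pi} f \<Longrightarrow> bdd_meas f"
  unfolding bdd_meas_def
  by (auto intro!: continuous_imp_measurable_on_sets_lebesgue compact_imp_bounded compact_continuous_image)

lemma bdd_meas_add:
  assumes "bdd_meas f" "bdd_meas g"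
  shows "bdd_meas (\<lambda>x. f x + g x)"
proof -
  obtain A B where "\<And>x. x \<in> {0..pi} \<Longrightarrow> \<bar>f x\<bar> \<le> A" "\<And>x. x \<in> {0..pi} \<Longrightarrow> \<bar>g x\<bar> \<le> B"
    using assms by (metis bdd_meas_bound)
  then show ?thesis
    by (intro bdd_measI[where B="A + B"])
      (use assms in \<open>auto simp: bdd_meas_def intro!: order_trans[OF abs_triangle_ineq] add_mono\<close>)
qed

lemma bdd_meas_mult:
  assumes "bdd_meas f" "bdd_meas g"
  shows "bdd_meas (\<lambda>x. f x * g x)"
proof -
  obtain A B where "A \<ge> 0" "\<And>x. x \<in> {0..pi} \<Longrightarrow> \<bar>f x\<bar> \<le> A" "\<And>x. x \<in> {0..pi} \<Longrightarrow> \<bar>g x\<bar> \<le> B"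
    using assms by (metis bdd_meas_bound)
  then show ?thesis
    by (intro bdd_measI[where B="A * B"])
      (use assms in \<open>auto simp: bdd_meas_def abs_mult intro!: mult_mono\<close>)
qed

lemma continuous_on_sine [continuous_intros]: "continuous_on S (sine m)"
  unfolding sine_def by (intro continuous_intros)

lemma bdd_meas_const: "bdd_meas (\<lambda>x. c)"
  and bdd_meas_sine: "bdd_meas (sine m)"
  by (auto intro!: bdd_meas_continuous continuous_intros)

lemma bdd_meas_diff:
  assumes "bdd_meas f" "bdd_meas g"
  shows "bdd_meas (\<lambda>x. f x - g x)"
  using bdd_meas_add[OF assms(1) bdd_meas_mult[OF bdd_meas_const[of "-1"] assms(2)]] by simp

lemma bdd_meas_sum:
  assumes "\<And>i. i \<in> I \<Longrightarrow> bdd_meas (f i)"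
  shows "bdd_meas (\<lambda>x. \<Sum>i\<in>I. f i x)"
  using assms by (induction I rule: infinite_finite_induct) (auto intro: bdd_meas_add bdd_meas_const)

lemmas bdd_meas_intros = bdd_meas_const bdd_meas_sine bdd_meas_add bdd_meas_diff bdd_meas_mult bdd_meas_sum

lemma bdd_meas_integrable:
  assumes "bdd_meas f"
  shows "f integrable_on {0..pi}"
proof -
  obtain B where B: "\<And>x. x \<in> {0..pi} \<Longrightarrow> \<bar>f x\<bar> \<le> B" using assms by (metis bdd_meas_bound)
  show ?thesis
    by (rule measurable_bounded_by_integrable_imp_integrable_real[where g="\<lambda>x. B"])
      (use assms B in \<open>auto simp: bdd_meas_def\<close>)
qed

lemma ip_integrable: "bdd_meas f \<Longrightarrow> bdd_meas g \<Longrightarrow> (\<lambda>x. f x * g x) integrable_on {0..pi}"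
  by (intro bdd_meas_integrable bdd_meas_mult)

section \<open>The inner product on bounded measurable functions\<close>

lemma ip_commute: "ip f g = ip g f"
  by (simp add: ip_def mult.commute)

lemma ip_cong:
  assumes "\<And>x. x \<in> {0..pi} \<Longrightarrow> f x = f' x" "\<And>x. x \<in> {0..pi} \<Longrightarrow> g x = g' x"
  shows "ip f g = ip f' g'"
  unfolding ip_def by (rule integral_cong) (use assms in auto)

lemma ip_assoc: "ip (\<lambda>x. q x * f x) g = ip f (\<lambda>x. q x * g x)"
  by (simp add: ip_def mult_ac)

lemma ip_scale [simp]:
  "ip (\<lambda>x. r * f x) g = r * ip f g" "ip g (\<lambda>x. r * f x) = r * ip g f"
  by (simp_all add: ip_def mult.assoc mult.left_commute)

lemma ip_add:
  assumes "bdd_meas f" "bdd_meas g" "bdd_meas h"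
  shows "ip (\<lambda>x. f x + g x) h = ip f h + ip g h"
  using assms by (simp add: ip_def distrib_right integral_add ip_integrable)

lemma ip_diff:
  assumes "bdd_meas f" "bdd_meas g" "bdd_meas h"
  shows "ip (\<lambda>x. f x - g x) h = ip f h - ip g h"
  using assms by (simp add: ip_def left_diff_distrib integral_diff ip_integrable)

lemma ip_nonneg:
  assumes "bdd_meas f" shows "ip f f \<ge> 0"
  unfolding ip_def using assms by (intro integral_nonneg ip_integrable) auto

lemma ip_self_mono:
  assumes "bdd_meas f" "bdd_meas g" "\<And>x. x \<in> {0..pi} \<Longrightarrow> \<bar>f x\<bar> \<le> \<bar>g x\<bar>"
  shows "ip f f \<le> ip g g"
  unfolding ip_def using assms
  by (intro integral_le ip_integrable) (auto simp: abs_le_square_iff power2_eq_square[symmetric])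

lemma ip_self_eq_0:
  assumes "continuous_on {0..pi} f" "ip f f = 0" "x \<in> {0..pi}"
  shows "f x = 0"
proof -
  have "\<forall>x\<in>{0..pi}. f x * f x = 0"
    using assms(2) unfolding ip_def
    by (subst (asm) integral_eq_0_iff) (auto intro!: continuous_intros assms(1))
  then show ?thesis using assms(3) by auto
qed

text \<open>The constant \<open>suminf B * H\<close> dominates all partial sums, so dominated
  convergence permits termwise integration.\<close>

lemma ip_series:
  assumes f: "\<And>k. bdd_meas (f k)" and B: "\<And>k x. x \<in> {0..pi} \<Longrightarrow> \<bar>f k x\<bar> \<le> B k"
    and "summable B" and h: "bdd_meas h"
  shows "(\<lambda>k. ip (f k) h) sums ip (\<lambda>x. \<Sum>k. f k x) h"
proof -
  obtain H where H: "H \<ge> 0" "\<And>x. x \<in> {0..pi} \<Longrightarrow> \<bar>h x\<bar> \<le> H" using h by (metis bdd_meas_bound)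
  have B0: "B k \<ge> 0" for k using B[of 0 k] by force
  have "(\<lambda>N. integral {0..pi} (\<lambda>x. (\<Sum>k<N. f k x) * h x))
          \<longlonglongrightarrow> integral {0..pi} (\<lambda>x. (\<Sum>k. f k x) * h x)"
  proof (rule dominated_convergence(2)[where h="\<lambda>x. suminf B * H"])
    show "(\<lambda>x. (\<Sum>k<N. f k x) * h x) integrable_on {0..pi}" for N
      by (intro ip_integrable bdd_meas_intros f h)
    fix x assume x: "x \<in> {0..pi}"
    have "\<bar>\<Sum>k<N. f k x\<bar> \<le> suminf B" for N
      by (rule order_trans[OF sum_abs])
        (use B[OF x] in \<open>auto intro!: order_trans[OF sum_mono sum_le_suminf] \<open>summable B\<close> B0\<close>)
    then show "norm ((\<Sum>k<N. f k x) * h x) \<le> suminf B * H" for N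
      using H x by (auto simp: abs_mult intro!: mult_mono suminf_nonneg assms B0)
    have "summable (\<lambda>k. f k x)"
      by (rule summable_comparison_test'[OF \<open>summable B\<close>]) (use B[OF x] in auto)
    then show "(\<lambda>N. (\<Sum>k<N. f k x) * h x) \<longlonglongrightarrow> (\<Sum>k. f k x) * h x"
      by (intro tendsto_intros summable_LIMSEQ)
  qed auto
  moreover have "integral {0..pi} (\<lambda>x. (\<Sum>k<N. f k x) * h x) = (\<Sum>k<N. ip (f k) h)" for N
    by (simp add: sum_distrib_right ip_def integral_sum ip_integrable f h)
  ultimately show ?thesis by (simp add: sums_def ip_def[of _ h])
qed

lemma continuous_on_series:
  fixes f :: "nat \<Rightarrow> real \<Rightarrow> real"
  assumes "\<And>k. continuous_on S (f k)" "\<And>k x. x \<in> S \<Longrightarrow> \<bar>f k x\<bar> \<le> B k" "summable B"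
  shows "continuous_on S (\<lambda>x. \<Sum>k. f k x)"
  by (rule uniform_limit_theorem[OF _ Weierstrass_m_test[where M=B]])
    (use assms in \<open>auto intro!: always_eventually continuous_intros\<close>)

lemma sine_minus [simp]: "sine (- m) x = - sine m x"
  by (simp add: sine_def)

lemma sine_0 [simp]: "sine 0 x = 0"
  by (simp add: sine_def)

lemma sine_bound: "\<bar>sine m x\<bar> \<le> 1"
  by (simp add: sine_def)

section \<open>Orthogonality of the sines and Bessel's inequality\<close>

lemma integral_cos_int:
  fixes k :: int
  shows "((\<lambda>x. cos (of_int k * x)) has_integral (if k = 0 then pi else 0)) {0..pi}"
proof (cases "k = 0")
  case False
  have "((\<lambda>x. cos (of_int k * x)) has_integral
      (sin (of_int k * pi) / of_int k - sin (of_int k * 0) / of_int k)) {0..pi}"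
    by (rule fundamental_theorem_of_calculus)
      (use False in \<open>auto intro!: derivative_eq_intros simp: has_real_derivative_iff_has_vector_derivative[symmetric]\<close>)
  then show ?thesis using False by (simp add: mult.commute[of _ pi])
qed (use has_integral_const_real[of "1::real" 0 pi] in simp)

lemma sine_mult: "sine l x * sine m x = (cos (of_int (l - m) * x) - cos (of_int (l + m) * x)) / 2"
  by (simp add: sine_def sin_times_sin algebra_simps)

lemma ip_sine_sine:
  assumes "l \<ge> 0" "m \<ge> 1"
  shows "ip (sine l) (sine m) = (if l = m then pi / 2 else 0)"
proof -
  have "((\<lambda>x. (cos (of_int (l - m) * x) - cos (of_int (l + m) * x)) / 2) has_integral
     ((if l - m = 0 then pi else 0) - (if l + m = 0 then pi else 0)) / 2) {0..pi}"
    by (intro has_integral_divide has_integral_diff integral_cos_int)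
  then show ?thesis
    using assms unfolding ip_def sine_mult by (auto dest!: integral_unique split: if_splits)
qed

lemma sine_series_coeff:
  fixes g :: "nat \<Rightarrow> real"
  assumes "summable (\<lambda>l. \<bar>g l\<bar>)" "m \<ge> 1"
  shows "ip (\<lambda>x. \<Sum>l. g l * sine (int l) x) (sine (int m)) = pi / 2 * g m"
proof -
  have "(\<lambda>l. ip (\<lambda>x. g l * sine (int l) x) (sine (int m)))
      sums ip (\<lambda>x. \<Sum>l. g l * sine (int l) x) (sine (int m))"
    by (rule ip_series[where B="\<lambda>l. \<bar>g l\<bar>"])
      (use assms in \<open>auto intro!: bdd_meas_intros mult_left_le simp: abs_mult sine_bound\<close>)
  moreover have "(\<lambda>l. ip (\<lambda>x. g l * sine (int l) x) (sine (int m))) = (\<lambda>l. if l = m then pi / 2 * g l else 0)"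
    using assms(2) by (auto simp: ip_sine_sine)
  moreover have "(\<lambda>l. if l = m then pi / 2 * g l else 0) sums (pi / 2 * g m)"
    by (rule sums_single)
  ultimately show ?thesis by (simp only:) (rule sums_unique2)
qed

text \<open>The square norm of \<open>f - p\<close> is nonnegative, where \<open>p\<close> is the
  orthogonal projection of \<open>f\<close> onto the first \<open>N\<close> sines;
  \<open>2 / pi\<close> is the reciprocal of the square norm of a sine.\<close>

lemma bessel:
  assumes f: "bdd_meas f"
  shows "(\<Sum>l=1..N. 2 / pi * (ip f (sine (int l)))\<^sup>2) \<le> ip f f"
proof -
  define c where "c l = 2 / pi * ip f (sine (int l))" for l :: nat
  define p where "p x = (\<Sum>l=1..N. c l * sine (int l) x)" for x
  have p: "bdd_meas p" unfolding p_def by (intro bdd_meas_intros)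
  have ip_p: "ip p h = (\<Sum>l=1..N. c l * ip (sine (int l)) h)" if "bdd_meas h" for h
  proof -
    have "ip p h = (\<Sum>l=1..N. ip (\<lambda>x. c l * sine (int l) x) h)"
      unfolding ip_def p_def sum_distrib_right
      by (intro integral_sum ip_integrable bdd_meas_intros that) auto
    then show ?thesis by simp
  qed
  have "ip p (sine (int m)) = pi / 2 * c m" if "m \<in> {1..N}" for m
    using that by (simp add: ip_p bdd_meas_sine ip_sine_sine sum.delta if_distrib cong: if_cong)
  then have "ip p p = (\<Sum>l=1..N. pi / 2 * (c l)\<^sup>2)"
    by (subst ip_p[OF p]) (auto simp: ip_commute[of _ p] power2_eq_square intro!: sum.cong)
  moreover have "ip p f = (\<Sum>l=1..N. pi / 2 * (c l)\<^sup>2)"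
    by (subst ip_p[OF f]) (auto simp: ip_commute[of _ f] c_def power2_eq_square intro!: sum.cong)
  moreover have "0 \<le> ip (\<lambda>x. f x - p x) (\<lambda>x. f x - p x)"
    by (intro ip_nonneg bdd_meas_intros f p)
  moreover have "ip (\<lambda>x. f x - p x) (\<lambda>x. f x - p x)
      = ip f (\<lambda>x. f x - p x) - ip p (\<lambda>x. f x - p x)"
    using f p by (simp add: ip_diff bdd_meas_diff)
  moreover have "ip g (\<lambda>x. f x - p x) = ip f g - ip p g" if "bdd_meas g" for g
    using f p that by (subst ip_commute) (simp add: ip_diff)
  then have "ip f (\<lambda>x. f x - p x) = ip f f - ip p f" "ip p (\<lambda>x. f x - p x) = ip f p - ip p p"
    using f p by auto
  moreover have "ip f p = ip p f" by (rule ip_commute)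
  moreover have "(\<Sum>l=1..N. pi / 2 * (c l)\<^sup>2) = (\<Sum>l=1..N. 2 / pi * (ip f (sine (int l)))\<^sup>2)"
    by (rule sum.cong) (auto simp: c_def power2_eq_square)
  ultimately show ?thesis by linarith
qed

section \<open>Completeness of the sines\<close>

lemma ip_bound:
  assumes "bdd_meas f" "bdd_meas g"
    and "\<And>x. x \<in> {0..pi} \<Longrightarrow> \<bar>f x\<bar> \<le> A" "\<And>x. x \<in> {0..pi} \<Longrightarrow> \<bar>g x\<bar> \<le> B"
  shows "\<bar>ip f g\<bar> \<le> A * B * pi"
proof -
  have "0 \<le> A" using assms(3)[of 0] by force
  then have "norm (ip f g) \<le> integral {0..pi} (\<lambda>x. A * B)"
    unfolding ip_def
    by (intro integral_norm_bound_integral ip_integrable assms)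
      (use assms in \<open>auto simp: abs_mult intro!: mult_mono bdd_meas_const\<close>)
  then show ?thesis by (simp add: mult_ac)
qed

text \<open>The functions \<open>sine m\<close> span \<open>sin x * p (cos x)\<close> for all polynomials \<open>p\<close>, and by
  Weierstrass these approximate \<open>sin x * g x\<close> for every continuous \<open>g\<close>.\<close>

lemma sine_complete:
  assumes f: "continuous_on {0..pi} f" and zero: "\<And>m::nat. m \<ge> 1 \<Longrightarrow> ip f (sine (int m)) = 0"
    and x: "x \<in> {0..pi}"
  shows "f x = 0"
proof -
  have bf: "bdd_meas f" using f by (rule bdd_meas_continuous)
  \<comment> \<open>\<open>cos x * sine m x\<close> is the mean of \<open>sine (m + 1) x\<close> and
    \<open>sine (m - 1) x\<close>. The induction can leave the positive frequencies, so the claim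
    covers every integer \<open>m\<close>.\<close>
  have cosk: "ip f (\<lambda>x. cos x ^ k * sine m x) = 0" for k m
  proof (induction k arbitrary: m)
    case 0
    consider "m > 0" | "m = 0" | "- m > 0" by linarith
    then show ?case
    proof cases
      case 1 then show ?thesis using zero[of "nat m"] by simp
    next
      case 2 then show ?thesis by (simp add: ip_def)
    next
      case 3
      have "ip f (\<lambda>x. - 1 * sine (- m) x) = - 1 * ip f (sine (- m))"
        by (rule ip_scale)
      then show ?thesis using zero[of "nat (- m)"] 3 by simp
    qed
  next
    case (Suc k)
    have eq: "cos x ^ Suc k * sine m x
        = 1/2 * (cos x ^ k * sine (m + 1) x) + 1/2 * (cos x ^ k * sine (m - 1) x)" for x
      by (simp add: sine_def algebra_simps sin_add sin_diff)
    have c: "bdd_meas (\<lambda>x. cos x ^ k * sine j x)" for j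
      by (intro bdd_meas_continuous continuous_intros)
    have "ip (\<lambda>x. 1/2 * (cos x ^ k * sine (m + 1) x) + 1/2 * (cos x ^ k * sine (m - 1) x)) f
        = 1/2 * ip (\<lambda>x. cos x ^ k * sine (m + 1) x) f + 1/2 * ip (\<lambda>x. cos x ^ k * sine (m - 1) x) f"
      using bf c by (subst ip_add) (simp_all only: ip_scale bdd_meas_mult bdd_meas_const)
    then show ?case unfolding eq using Suc by (simp add: ip_commute[of _ f])
  qed
  \<comment> \<open>The factor \<open>sin x\<close> is \<open>sine 1\<close>, so \<open>cosk\<close>
    makes \<open>h\<close> orthogonal to every polynomial in \<open>cos x\<close>.\<close>
  define h where "h x = f x * sin x" for x
  have ch: "continuous_on {0..pi} h" unfolding h_def by (intro continuous_intros f)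
  then have bh: "bdd_meas h" by (rule bdd_meas_continuous)
  obtain B where B: "B \<ge> 0" "\<And>x. x \<in> {0..pi} \<Longrightarrow> \<bar>h x\<bar> \<le> B" using bh by (metis bdd_meas_bound)
  have le: "ip h h \<le> B * e * pi" if "e > 0" for e
  proof -
    \<comment> \<open>The substitution \<open>t = cos x\<close> turns approximation by polynomials
      in \<open>cos x\<close> into the Weierstrass theorem on \<open>{-1..1}\<close>.\<close>
    have "continuous_on {-1..1} (\<lambda>t. h (arccos t))"
      by (rule continuous_on_compose2[OF ch continuous_on_arccos'])
        (auto intro: arccos_lbound arccos_ubound)
    then obtain g where g: "real_polynomial_function g"
        "\<And>t. t \<in> {-1..1} \<Longrightarrow> \<bar>h (arccos t) - g t\<bar> < e"
      using Stone_Weierstrass_real_polynomial_function[of "{-1..1::real}"] \<open>e > 0\<close> by blast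
    obtain a N where a: "g = (\<lambda>x. \<Sum>i\<le>N. a i * x ^ i)"
      using g(1) unfolding real_polynomial_function_iff_sum by blast
    have bg: "bdd_meas (\<lambda>x. g (cos x))"
      unfolding a by (intro bdd_meas_continuous continuous_intros)
    have "ip h (\<lambda>x. g (cos x)) = integral {0..pi} (\<lambda>x. \<Sum>i\<le>N. a i * (f x * (cos x ^ i * sine 1 x)))"
      unfolding ip_def a h_def sine_def by (simp add: sum_distrib_left sum_distrib_right mult_ac)
    also have "\<dots> = (\<Sum>i\<le>N. integral {0..pi} (\<lambda>x. a i * (f x * (cos x ^ i * sine 1 x))))"
      by (intro integral_sum) (auto intro!: bdd_meas_integrable bdd_meas_intros bf
          bdd_meas_continuous[of "\<lambda>x. cos x ^ _"] continuous_intros)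
    also have "\<dots> = 0" using cosk by (simp add: ip_def)
    finally have "ip (\<lambda>x. g (cos x)) h = 0" by (simp add: ip_commute)
    then have "ip h h = ip (\<lambda>x. h x - g (cos x)) h" by (simp add: ip_diff bh bg)
    also have "\<dots> \<le> \<bar>\<dots>\<bar>" by simp
    also have "\<dots> \<le> e * B * pi"
    proof (rule ip_bound)
      fix x :: real assume "x \<in> {0..pi}"
      then show "\<bar>h x - g (cos x)\<bar> \<le> e" using g(2)[of "cos x"] by (simp add: arccos_cos)
    qed (use B bh bg in \<open>auto intro: bdd_meas_intros\<close>)
    finally show ?thesis by (simp add: mult_ac)
  qed
  have "ip h h \<le> 0 + e" if "e > 0" for e
  proof -
    \<comment> \<open>\<open>B + 1\<close> in place of \<open>B\<close> keeps the chosen tolerance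
      positive when \<open>B = 0\<close>.\<close>
    have "ip h h \<le> B * (e / ((B + 1) * pi)) * pi"
      using le[of "e / ((B + 1) * pi)"] that B(1) by simp
    also have "\<dots> = B / (B + 1) * e" by simp
    also have "\<dots> \<le> 1 * e" using that B(1) by (intro mult_right_mono) auto
    finally show ?thesis by simp
  qed
  then have "ip h h \<le> 0" by (rule field_le_epsilon)
  then have "ip h h = 0" using ip_nonneg[OF bh] by simp
  then have "h x = 0" if "x \<in> {0..pi}" for x using ip_self_eq_0[OF ch] that by blast
  then have "f x = 0" if "x \<in> {0<..<pi}" for x
    using that sin_gt_zero[of x] \<open>\<And>x. x \<in> {0..pi} \<Longrightarrow> h x = 0\<close>[of x] by (simp add: h_def)
  \<comment> \<open>At \<open>0\<close> and \<open>pi\<close> the factor \<open>sin x\<close>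
    vanishes, so there the value of \<open>f\<close> comes from continuity.\<close>
  then show ?thesis
    using continuous_constant_on_closure[of "{0<..<pi}" f 0 x] f x by simp
qed

text \<open>Two integrations by parts in one: off the finite set \<open>\<Phi>\<close> is an
  antiderivative of \<open>f * sine m + m^2 * w * sine m\<close>, and it vanishes at both ends
  because \<open>w\<close> and \<open>sin (m * x)\<close> do.\<close>

lemma sine_coeff_second_derivative:
  assumes w0: "w 0 = 0" "w pi = 0"
    and w: "\<And>x. x \<in> {0..pi} \<Longrightarrow> (w has_real_derivative w' x) (at x within {0..pi})"
    and w': "continuous_on {0..pi} w'" "finite S"
      "\<And>x. x \<in> {0..pi} - S \<Longrightarrow> (w' has_real_derivative f x) (at x within {0..pi})"
    and f: "bdd_meas f"
  shows "ip f (sine m) = - (of_int m)\<^sup>2 * ip w (sine m)"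
proof -
  have cw: "continuous_on {0..pi} w"
    using w by (rule DERIV_continuous_on)
  define \<Phi> where "\<Phi> x = w' x * sin (of_int m * x) - of_int m * w x * cos (of_int m * x)" for x
  have "((\<lambda>x. f x * sine m x + (of_int m)\<^sup>2 * w x * sine m x) has_integral (\<Phi> pi - \<Phi> 0)) {0..pi}"
  proof (rule fundamental_theorem_of_calculus_interior_strong[OF \<open>finite S\<close>])
    show "continuous_on {0..pi} \<Phi>" unfolding \<Phi>_def by (intro continuous_intros cw w')
    fix x assume x: "x \<in> {0<..<pi} - S"
    then have "at x within {0..pi} = at x" by (simp add: at_within_Icc_at)
    then have [derivative_intros]: "(w has_real_derivative w' x) (at x)" "(w' has_real_derivative f x) (at x)"
      using w[of x] w'(3)[of x] x by auto
    show "(\<Phi> has_vector_derivative f x * sine m x + (of_int m)\<^sup>2 * w x * sine m x) (at x)"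
      unfolding \<Phi>_def sine_def has_real_derivative_iff_has_vector_derivative[symmetric]
      by (auto intro!: derivative_eq_intros simp: algebra_simps power2_eq_square)
  qed auto
  moreover have "\<Phi> pi - \<Phi> 0 = 0"
    by (simp add: \<Phi>_def w0 mult.commute[of _ pi])
  ultimately have "integral {0..pi} (\<lambda>x. f x * sine m x + (of_int m)\<^sup>2 * w x * sine m x) = 0"
    by (simp add: integral_unique)
  moreover have "integral {0..pi} (\<lambda>x. f x * sine m x + (of_int m)\<^sup>2 * w x * sine m x)
      = ip f (sine m) + ip (\<lambda>x. (of_int m)\<^sup>2 * w x) (sine m)"
    unfolding ip_def using f bdd_meas_continuous[OF cw]
    by (intro integral_add ip_integrable bdd_meas_intros)
  ultimately show ?thesis by simp
qed

text \<open>Integrate \<open>f\<close> twice from \<open>0\<close> and subtract the multiple of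
  \<open>x\<close> that restores the condition at \<open>pi\<close>.\<close>

lemma dirichlet_solution_exists:
  assumes f: "bdd_meas f" and "finite S"
    and cont: "\<And>x. x \<in> {0..pi} - S \<Longrightarrow> continuous (at x within {0..pi}) f"
  obtains w w' where "w 0 = 0" "w pi = 0"
    "\<And>x. x \<in> {0..pi} \<Longrightarrow> (w has_real_derivative w' x) (at x within {0..pi})"
    "continuous_on {0..pi} w'"
    "\<And>x. x \<in> {0..pi} - S \<Longrightarrow> (w' has_real_derivative f x) (at x within {0..pi})"
proof -
  define u where "u x = integral {0..x} f" for x
  have cu: "continuous_on {0..pi} u"
    unfolding u_def by (intro indefinite_integral_continuous_1 bdd_meas_integrable f)
  define v where "v x = integral {0..x} u" for x
  have v: "(v has_real_derivative u x) (at x within {0..pi})" if "x \<in> {0..pi}" for x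
    unfolding v_def by (rule integral_has_real_derivative[OF cu that])
  have u: "(u has_real_derivative f x) (at x within {0..pi})" if x: "x \<in> {0..pi} - S" for x
  proof -
    have "(u has_vector_derivative f x) (at x within ({0..pi} - S))"
      unfolding u_def
      by (rule integral_has_vector_derivative_continuous_at[OF bdd_meas_integrable[OF f] x \<open>finite S\<close>])
        (use cont[OF x] in \<open>auto intro: continuous_within_subset\<close>)
    moreover have "at x within ({0..pi} - S) = at x within {0..pi}"
      by (rule at_within_nhd[where S="- S"]) (use x \<open>finite S\<close> in \<open>auto intro: finite_imp_closed\<close>)
    ultimately show ?thesis by (simp add: has_real_derivative_iff_has_vector_derivative)
  qed
  show thesis
  proof (rule that[of "\<lambda>x. v x - x * (v pi / pi)" "\<lambda>x. u x - v pi / pi"])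
    show "((\<lambda>x. v x - x * (v pi / pi)) has_real_derivative u x - v pi / pi) (at x within {0..pi})"
      if "x \<in> {0..pi}" for x
      using v[OF that] by (auto intro!: derivative_eq_intros)
    show "((\<lambda>x. u x - v pi / pi) has_real_derivative f x) (at x within {0..pi})"
      if "x \<in> {0..pi} - S" for x
      using u[OF that] by (auto intro!: derivative_eq_intros)
  qed (auto simp: v_def intro!: continuous_intros cu)
qed

section \<open>The reduced resolvent and its Neumann series\<close>

lemma summable_inverse_dist_squares:
  "summable (\<lambda>l. 1 / \<bar>lam - (real l)\<^sup>2\<bar>)"
proof (rule summable_comparison_test_ev)
  show "summable (\<lambda>l. 2 * inverse (real l ^ 2))"
    by (intro summable_mult inverse_power_summable) simp
  \<comment> \<open>From here on \<bar>lam\<bar> is at most half of \<open>l^2\<close>, so the other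
    half remains. An index with \<open>lam = l^2\<close>, where the term is
    \<open>1 / 0 = 0\<close>, can only occur earlier.\<close>
  obtain N :: nat where N: "2 * \<bar>lam\<bar> + 1 \<le> real N" using real_arch_simple by blast
  show "\<forall>\<^sub>F l in sequentially. norm (1 / \<bar>lam - (real l)\<^sup>2\<bar>) \<le> 2 * inverse (real l ^ 2)"
  proof (rule eventually_sequentiallyI[of N])
    fix l assume "N \<le> l"
    then have l: "2 * \<bar>lam\<bar> + 1 \<le> real l" using N by linarith
    then have "real l * 1 \<le> real l * real l" by (intro mult_left_mono) auto
    then have "(real l)\<^sup>2 / 2 \<le> \<bar>lam - (real l)\<^sup>2\<bar>" "0 < (real l)\<^sup>2 / 2"
      using l by (auto simp: power2_eq_square)
    then have "1 / \<bar>lam - (real l)\<^sup>2\<bar> \<le> 1 / ((real l)\<^sup>2 / 2)"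
      by (intro divide_left_mono mult_pos_pos) linarith+
    then show "norm (1 / \<bar>lam - (real l)\<^sup>2\<bar>) \<le> 2 * inverse (real l ^ 2)"
      by (simp add: field_simps)
  qed
qed

text \<open>\<open>M / \<delta> < 1\<close> will be the contraction factor. The distance
  \<open>\<delta>\<close> stays abstract because its value depends on whether \<open>n^2\<close> has
  a neighbouring square below it.\<close>

locale gapped_dirichlet =
  fixes q :: "real \<Rightarrow> real" and M \<delta> lam :: real and n :: nat
  assumes q: "bdd_meas q" and q_le: "\<And>x. x \<in> {0..pi} \<Longrightarrow> \<bar>q x\<bar> \<le> M"
    and n: "n \<ge> 1" and M_less: "M < \<delta>"
    and gap: "\<And>m::nat. m \<ge> 1 \<Longrightarrow> m \<noteq> n \<Longrightarrow> \<delta> \<le> \<bar>lam - (real m)\<^sup>2\<bar>"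
begin

lemma M_nonneg: "0 \<le> M" and \<delta>_pos: "0 < \<delta>"
proof -
  show "0 \<le> M" using q_le[of 0] by force
  then show "0 < \<delta>" using M_less by linarith
qed

lemma gap_nonzero: "m \<ge> 1 \<Longrightarrow> m \<noteq> n \<Longrightarrow> lam - (real m)\<^sup>2 \<noteq> 0"
  using gap[of m] \<delta>_pos by auto

text \<open>The mode \<open>n\<close> is cut out because \<open>lam\<close> may equal
  \<open>n^2\<close>; the mode \<open>0\<close> contributes nothing since \<open>sine 0\<close>
  vanishes.\<close>

definition gcoef :: "(real \<Rightarrow> real) \<Rightarrow> nat \<Rightarrow> real" where
  "gcoef f l = (if l = n then 0 else 2 / pi * ip f (sine (int l)) / (lam - (real l)\<^sup>2))"

text \<open>The inverse of \<open>\<lambda> + d\<^sup>2/dx\<^sup>2\<close> on the orthogonal complement of \<open>sin n x\<close>.\<close>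

definition red_res :: "(real \<Rightarrow> real) \<Rightarrow> real \<Rightarrow> real" where
  "red_res f x = (\<Sum>l. gcoef f l * sine (int l) x)"

text \<open>The constant that converts a mean square bound on \<open>f\<close> into a uniform bound
  on \<open>red_res f\<close>.\<close>

definition Rsum :: real where
  "Rsum = (\<Sum>l. 1 / \<bar>lam - (real l)\<^sup>2\<bar>)"

lemma abs_coeff_le:
  assumes "bdd_meas f"
  shows "\<bar>2 / pi * ip f (sine (int l))\<bar> \<le> sqrt (2 / pi * ip f f)"
proof (cases "l = 0")
  case True
  then show ?thesis using ip_nonneg[OF assms] by (simp add: ip_def)
next
  case False
  have "2 / pi * (ip f (sine (int l)))\<^sup>2 \<le> (\<Sum>j=1..l. 2 / pi * (ip f (sine (int j)))\<^sup>2)"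
    by (rule member_le_sum) (use False in auto)
  also have "\<dots> \<le> ip f f" by (rule bessel[OF assms])
  finally have "2 / pi * (2 / pi * (ip f (sine (int l)))\<^sup>2) \<le> 2 / pi * ip f f"
    by (intro mult_left_mono) auto
  then show ?thesis
    by (intro real_le_rsqrt) (simp add: power_mult_distrib power2_eq_square mult_ac)
qed

lemma abs_gcoef_le:
  assumes "bdd_meas f"
  shows "\<bar>gcoef f l\<bar> \<le> sqrt (2 / pi * ip f f) * (1 / \<bar>lam - (real l)\<^sup>2\<bar>)"
proof -
  have "\<bar>gcoef f l\<bar> \<le> \<bar>2 / pi * ip f (sine (int l))\<bar> * (1 / \<bar>lam - (real l)\<^sup>2\<bar>)"
    by (simp add: gcoef_def abs_mult)
  also have "\<dots> \<le> sqrt (2 / pi * ip f f) * (1 / \<bar>lam - (real l)\<^sup>2\<bar>)"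
    by (intro mult_right_mono abs_coeff_le assms) simp
  finally show ?thesis .
qed

lemma summable_gcoef: "bdd_meas f \<Longrightarrow> summable (\<lambda>l. \<bar>gcoef f l\<bar>)"
  by (rule summable_comparison_test'[OF summable_mult[OF summable_inverse_dist_squares], where N=0])
    (use abs_gcoef_le in auto)

lemma abs_gcoef_sine_le: "\<bar>gcoef f l * sine (int l) x\<bar> \<le> \<bar>gcoef f l\<bar>"
  by (simp add: abs_mult mult_left_le sine_bound)

lemma continuous_on_red_res: "bdd_meas f \<Longrightarrow> continuous_on S (red_res f)"
  unfolding red_res_def
  by (rule continuous_on_series[OF _ abs_gcoef_sine_le summable_gcoef])
    (auto intro!: continuous_intros)

lemma bdd_meas_red_res: "bdd_meas f \<Longrightarrow> bdd_meas (red_res f)"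
  by (rule bdd_meas_continuous, rule continuous_on_red_res)

lemma abs_red_res_le:
  assumes "bdd_meas f"
  shows "\<bar>red_res f x\<bar> \<le> sqrt (2 / pi * ip f f) * Rsum"
proof -
  have s: "summable (\<lambda>l. \<bar>gcoef f l * sine (int l) x\<bar>)"
    by (rule summable_comparison_test'[OF summable_gcoef[OF assms], where N=0])
      (use abs_gcoef_sine_le in auto)
  have "\<bar>red_res f x\<bar> \<le> (\<Sum>l. \<bar>gcoef f l * sine (int l) x\<bar>)"
    unfolding red_res_def by (rule summable_rabs[OF s])
  also have "\<dots> \<le> (\<Sum>l. sqrt (2 / pi * ip f f) * (1 / \<bar>lam - (real l)\<^sup>2\<bar>))"
    by (intro suminf_le order_trans[OF abs_gcoef_sine_le abs_gcoef_le[OF assms]] s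
        summable_mult summable_inverse_dist_squares)
  also have "\<dots> = sqrt (2 / pi * ip f f) * Rsum"
    unfolding Rsum_def by (intro suminf_mult summable_inverse_dist_squares)
  finally show ?thesis .
qed

lemma ip_red_res_sine:
  assumes "bdd_meas f" "m \<ge> 1"
  shows "ip (red_res f) (sine (int m)) = (if m = n then 0 else ip f (sine (int m)) / (lam - (real m)\<^sup>2))"
proof -
  have "ip (red_res f) (sine (int m)) = pi / 2 * gcoef f m"
    unfolding red_res_def[abs_def] by (rule sine_series_coeff[OF summable_gcoef[OF assms(1)] assms(2)])
  also have "\<dots> = (if m = n then 0 else ip f (sine (int m)) / (lam - (real m)\<^sup>2))"
    by (simp add: gcoef_def)
  finally show ?thesis .
qed

text \<open>Expanding one factor as a sine series gives the Bessel terms of \<open>f\<close> divided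
  by \<open>(lam - l^2)^2\<close>, which is at least \<open>\<delta>^2\<close>; the modes
  \<open>0\<close> and \<open>n\<close> drop out. Bessel's inequality then bounds all partial
  sums.\<close>

lemma ip_red_res_le:
  assumes f: "bdd_meas f"
  shows "ip (red_res f) (red_res f) \<le> ip f f / \<delta>\<^sup>2"
proof -
  have "(\<lambda>l. ip (\<lambda>x. gcoef f l * sine (int l) x) (red_res f)) sums ip (red_res f) (red_res f)"
    unfolding red_res_def[of f, abs_def]
    by (rule ip_series[OF _ abs_gcoef_sine_le summable_gcoef])
      (use f bdd_meas_red_res[OF f] in \<open>auto intro!: bdd_meas_intros simp: red_res_def[abs_def]\<close>)
  then have "(\<lambda>N. \<Sum>l<N. ip (\<lambda>x. gcoef f l * sine (int l) x) (red_res f)) \<longlonglongrightarrow> ip (red_res f) (red_res f)"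
    by (simp add: sums_def)
  moreover have "(\<Sum>l<N. ip (\<lambda>x. gcoef f l * sine (int l) x) (red_res f)) \<le> ip f f / \<delta>\<^sup>2" for N
  proof -
    have "ip (\<lambda>x. gcoef f l * sine (int l) x) (red_res f)
        \<le> (if l = 0 then 0 else 2 / pi * (ip f (sine (int l)))\<^sup>2 / \<delta>\<^sup>2)" for l
    proof (cases "l = 0 \<or> l = n")
      case True
      then show ?thesis using n by (auto simp: gcoef_def ip_def)
    next
      case False
      have "\<delta>\<^sup>2 \<le> (lam - (real l)\<^sup>2)\<^sup>2"
        using gap[of l] False \<delta>_pos by (simp add: abs_le_square_iff[symmetric])
      moreover have "0 < \<delta>\<^sup>2" using \<delta>_pos by (rule zero_less_power)
      ultimately have "2 / pi * (ip f (sine (int l)))\<^sup>2 / (lam - (real l)\<^sup>2)\<^sup>2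
          \<le> 2 / pi * (ip f (sine (int l)))\<^sup>2 / \<delta>\<^sup>2"
        by (intro divide_left_mono mult_pos_pos) auto
      moreover have "ip (\<lambda>x. gcoef f l * sine (int l) x) (red_res f) = gcoef f l * ip (sine (int l)) (red_res f)"
        by (rule ip_scale)
      moreover have "ip (sine (int l)) (red_res f) = ip f (sine (int l)) / (lam - (real l)\<^sup>2)"
        using False f by (subst ip_commute) (simp add: ip_red_res_sine)
      then have "gcoef f l * ip (sine (int l)) (red_res f)
          = 2 / pi * (ip f (sine (int l)))\<^sup>2 / (lam - (real l)\<^sup>2)\<^sup>2"
        using False by (simp add: gcoef_def power2_eq_square mult.assoc)
      ultimately show ?thesis using False by simp
    qed
    then have "(\<Sum>l<N. ip (\<lambda>x. gcoef f l * sine (int l) x) (red_res f))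
        \<le> (\<Sum>l<N. if l = 0 then 0 else 2 / pi * (ip f (sine (int l)))\<^sup>2 / \<delta>\<^sup>2)"
      by (rule sum_mono)
    also have "\<dots> = (\<Sum>l\<in>{..<N}-{0}. 2 / pi * (ip f (sine (int l)))\<^sup>2 / \<delta>\<^sup>2)"
      by (rule sum.mono_neutral_cong_right) auto
    also have "\<dots> \<le> (\<Sum>l=1..N. 2 / pi * (ip f (sine (int l)))\<^sup>2 / \<delta>\<^sup>2)"
      by (rule sum_mono2) auto
    also have "\<dots> = (\<Sum>l=1..N. 2 / pi * (ip f (sine (int l)))\<^sup>2) / \<delta>\<^sup>2"
      by (simp only: sum_divide_distrib)
    also have "\<dots> \<le> ip f f / \<delta>\<^sup>2" by (intro divide_right_mono bessel f) simp
    finally show ?thesis .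
  qed
  ultimately show ?thesis by (intro LIMSEQ_le_const2) auto
qed

lemma bdd_meas_qmult: "bdd_meas f \<Longrightarrow> bdd_meas (\<lambda>x. q x * f x)"
  by (intro bdd_meas_mult q)

lemma ip_qmult_le:
  assumes "bdd_meas f"
  shows "ip (\<lambda>x. q x * f x) (\<lambda>x. q x * f x) \<le> M\<^sup>2 * ip f f"
proof -
  have "ip (\<lambda>x. q x * f x) (\<lambda>x. q x * f x) \<le> ip (\<lambda>x. M * f x) (\<lambda>x. M * f x)"
    by (rule ip_self_mono)
      (use assms q_le M_nonneg in \<open>auto intro!: bdd_meas_intros q mult_right_mono simp: abs_mult\<close>)
  then show ?thesis by (simp add: power2_eq_square)
qed

text \<open>Comparing all sine coefficients shows that \<open>w\<close> is a fixed point of the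
  contraction that multiplies by \<open>q\<close> and applies \<open>red_res\<close>. Its norm is
  therefore 0, and continuity makes it vanish pointwise.\<close>

lemma reduced_equation_unique:
  assumes w: "continuous_on {0..pi} w" and "ip w (sine (int n)) = 0"
    and eq: "\<And>m::nat. m \<ge> 1 \<Longrightarrow> m \<noteq> n \<Longrightarrow>
      (lam - (real m)\<^sup>2) * ip w (sine (int m)) = ip (\<lambda>x. q x * w x) (sine (int m))"
    and x: "x \<in> {0..pi}"
  shows "w x = 0"
proof -
  have bw: "bdd_meas w" using w by (rule bdd_meas_continuous)
  note bq = bdd_meas_qmult[OF bw]
  have "w x - red_res (\<lambda>x. q x * w x) x = 0" if "x \<in> {0..pi}" for x
  proof (rule sine_complete[OF _ _ that])
    show "continuous_on {0..pi} (\<lambda>x. w x - red_res (\<lambda>x. q x * w x) x)"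
      by (intro continuous_intros w continuous_on_red_res bq)
    fix m :: nat assume m: "m \<ge> 1"
    have "ip (\<lambda>x. w x - red_res (\<lambda>x. q x * w x) x) (sine (int m))
        = ip w (sine (int m)) - ip (red_res (\<lambda>x. q x * w x)) (sine (int m))"
      by (intro ip_diff bdd_meas_red_res bw bq bdd_meas_sine)
    then show "ip (\<lambda>x. w x - red_res (\<lambda>x. q x * w x) x) (sine (int m)) = 0"
      using m assms(2) eq[OF m, symmetric] gap_nonzero[OF m]
      by (auto simp: ip_red_res_sine[OF bq])
  qed
  then have "ip w w = ip (red_res (\<lambda>x. q x * w x)) (red_res (\<lambda>x. q x * w x))"
    by (intro ip_cong) auto
  also have "\<dots> \<le> M\<^sup>2 * ip w w / \<delta>\<^sup>2"
    by (rule order_trans[OF ip_red_res_le[OF bq]]) (intro divide_right_mono ip_qmult_le bw, simp)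
  finally have "\<delta>\<^sup>2 * ip w w \<le> M\<^sup>2 * ip w w" using \<delta>_pos by (simp add: field_simps)
  moreover have "M\<^sup>2 < \<delta>\<^sup>2" using M_less M_nonneg by (intro power_strict_mono) auto
  ultimately have "ip w w \<le> 0" using mult_strict_right_mono[of "M\<^sup>2" "\<delta>\<^sup>2" "ip w w"] by linarith
  then show ?thesis using ip_nonneg[OF bw] ip_self_eq_0[OF w _ x] by simp
qed

text \<open>\<open>src k\<close> keeps an outer factor \<open>q\<close>: then
  \<open>red_res (src k)\<close> is the Neumann term with index \<open>k\<close>, and for
  \<open>k \<ge> 1\<close> the pairing of \<open>src k\<close> with \<open>sine n\<close> is, up to
  \<open>2 / pi\<close>, the coefficient \<open>a_k\<close>.\<close>

primrec src :: "nat \<Rightarrow> real \<Rightarrow> real" where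
  "src 0 = (\<lambda>x. q x * sine (int n) x)"
| "src (Suc k) = (\<lambda>x. q x * red_res (src k) x)"

lemma bdd_meas_src: "bdd_meas (src k)"
  by (induction k) (auto intro!: bdd_meas_qmult bdd_meas_sine bdd_meas_red_res)

text \<open>In the square norm, multiplication by \<open>q\<close> costs at most \<open>M^2\<close>
  and the reduced resolvent gains \<open>1 / \<delta>^2\<close>; \<open>pi / 2\<close> is the square
  norm of \<open>sine n\<close>.\<close>

lemma ip_src_le: "ip (src k) (src k) \<le> ((M / \<delta>)\<^sup>2) ^ k * (M\<^sup>2 * (pi / 2))"
proof (induction k)
  case 0
  then show ?case using ip_qmult_le[OF bdd_meas_sine[of "int n"]] n by (simp add: ip_sine_sine)
next
  case (Suc k)
  have "ip (src (Suc k)) (src (Suc k)) \<le> M\<^sup>2 * ip (red_res (src k)) (red_res (src k))"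
    by (simp add: ip_qmult_le bdd_meas_red_res bdd_meas_src)
  also have "\<dots> \<le> M\<^sup>2 * (ip (src k) (src k) / \<delta>\<^sup>2)"
    by (intro mult_left_mono ip_red_res_le bdd_meas_src) simp
  also have "\<dots> = (M / \<delta>)\<^sup>2 * ip (src k) (src k)" by (simp add: power_divide)
  also have "\<dots> \<le> (M / \<delta>)\<^sup>2 * (((M / \<delta>)\<^sup>2) ^ k * (M\<^sup>2 * (pi / 2)))"
    by (intro mult_left_mono Suc) simp
  finally show ?case by (simp add: mult.assoc)
qed

lemma abs_red_res_src_le: "\<bar>red_res (src k) x\<bar> \<le> (M / \<delta>) ^ k * (M * Rsum)"
proof -
  have "2 / pi * ip (src k) (src k) \<le> 2 / pi * (((M / \<delta>)\<^sup>2) ^ k * (M\<^sup>2 * (pi / 2)))"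
    by (intro mult_left_mono ip_src_le) simp
  also have "\<dots> = ((M / \<delta>) ^ k * M)\<^sup>2"
    by (simp add: power_mult_distrib power_mult[symmetric] mult.commute)
  finally have "sqrt (2 / pi * ip (src k) (src k)) \<le> (M / \<delta>) ^ k * M"
    using M_nonneg \<delta>_pos by (intro real_le_lsqrt) auto
  moreover have "0 \<le> Rsum"
    unfolding Rsum_def by (intro suminf_nonneg summable_inverse_dist_squares) auto
  ultimately have "sqrt (2 / pi * ip (src k) (src k)) * Rsum \<le> (M / \<delta>) ^ k * M * Rsum"
    by (intro mult_right_mono)
  then show ?thesis using abs_red_res_le[OF bdd_meas_src, of k x] by (simp add: mult.assoc)
qed

lemma summable_src_bound: "summable (\<lambda>k. (M / \<delta>) ^ k * (M * Rsum))"
  using M_less M_nonneg \<delta>_pos by (intro summable_mult2 summable_geometric) auto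

section \<open>The sum of the Neumann series\<close>

definition zsum :: "real \<Rightarrow> real" where
  "zsum x = (\<Sum>k. red_res (src k) x)"

lemma continuous_on_zsum: "continuous_on S zsum"
  unfolding zsum_def[abs_def]
  by (rule continuous_on_series[OF _ abs_red_res_src_le summable_src_bound])
    (intro continuous_on_red_res bdd_meas_src)

lemma bdd_meas_zsum: "bdd_meas zsum"
  by (intro bdd_meas_continuous continuous_on_zsum)

lemma ip_zsum_sums: "bdd_meas h \<Longrightarrow> (\<lambda>k. ip (red_res (src k)) h) sums ip zsum h"
  unfolding zsum_def[abs_def]
  by (rule ip_series[OF _ abs_red_res_src_le summable_src_bound])
    (auto intro: bdd_meas_red_res bdd_meas_src)

lemma ip_src_sums:
  assumes "bdd_meas h"
  shows "(\<lambda>k. ip (src (Suc k)) h) sums ip (\<lambda>x. q x * zsum x) h"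
  using ip_zsum_sums[OF bdd_meas_qmult[OF assms]] by (simp add: ip_assoc)

definition ysol :: "real \<Rightarrow> real" where
  "ysol x = sine (int n) x + zsum x"

lemma continuous_on_ysol: "continuous_on S ysol"
  unfolding ysol_def[abs_def] by (intro continuous_intros continuous_on_zsum)

lemma bdd_meas_ysol: "bdd_meas ysol"
  by (intro bdd_meas_continuous continuous_on_ysol)

text \<open>Every Neumann term lacks the mode \<open>n\<close>, so this value comes from the leading
  sine alone.\<close>

lemma ip_ysol_sine_n: "ip ysol (sine (int n)) = pi / 2"
proof -
  have "(\<lambda>k. 0) sums ip zsum (sine (int n))"
    using ip_zsum_sums[OF bdd_meas_sine, of "int n"] n by (simp add: ip_red_res_sine bdd_meas_src)
  then have "ip zsum (sine (int n)) = 0" by (rule sums_unique2) simp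
  then show ?thesis
    using n by (simp add: ysol_def[abs_def] ip_add bdd_meas_zsum bdd_meas_sine ip_sine_sine)
qed

text \<open>The term \<open>src 0\<close> comes from the leading sine of \<open>ysol\<close>, and
  \<open>zsum\<close> supplies the indices from \<open>1\<close> on.\<close>

lemma ip_q_ysol_sums:
  assumes "bdd_meas h"
  shows "(\<lambda>k. ip (src k) h) sums ip (\<lambda>x. q x * ysol x) h"
proof -
  have "ip (\<lambda>x. q x * ysol x) h = ip (\<lambda>x. q x * sine (int n) x) h + ip (\<lambda>x. q x * zsum x) h"
    unfolding ysol_def distrib_left
    by (intro ip_add bdd_meas_qmult bdd_meas_sine bdd_meas_zsum assms)
  then show ?thesis
    using ip_src_sums[OF assms] by (subst (asm) sums_Suc_iff) (simp add: add.commute)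
qed

text \<open>\<open>ysol\<close> solves the eigenvalue equation in every mode except possibly
  \<open>n\<close>, whether or not \<open>lam\<close> is an eigenvalue.\<close>

lemma ip_ysol_sine:
  assumes "m \<ge> 1" "m \<noteq> n"
  shows "(lam - (real m)\<^sup>2) * ip ysol (sine (int m)) = ip (\<lambda>x. q x * ysol x) (sine (int m))"
proof -
  have "(\<lambda>k. ip (src k) (sine (int m)) / (lam - (real m)\<^sup>2)) sums ip zsum (sine (int m))"
    using ip_zsum_sums[OF bdd_meas_sine, of "int m"] assms by (simp add: ip_red_res_sine bdd_meas_src)
  then have "ip zsum (sine (int m)) = ip (\<lambda>x. q x * ysol x) (sine (int m)) / (lam - (real m)\<^sup>2)"
    by (rule sums_unique2) (intro sums_divide ip_q_ysol_sums bdd_meas_sine)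
  moreover have "ip ysol (sine (int m)) = ip zsum (sine (int m))"
    using assms n by (simp add: ysol_def[abs_def] ip_add bdd_meas_zsum bdd_meas_sine ip_sine_sine)
  ultimately show ?thesis using gap_nonzero[OF assms] by simp
qed

text \<open>A Lyapunov-Schmidt reduction: the equations in the other modes determine the
  eigenfunction up to a factor as \<open>ysol\<close>, and the equation in the mode \<open>n\<close>
  remains as the condition on \<open>lam\<close>.\<close>

lemma eigenvalue_iff_ip:
  assumes S: "finite S" "\<And>x. x \<in> {0..pi} - S \<Longrightarrow> continuous (at x within {0..pi}) q"
  shows "is_eigenvalue_L q lam \<longleftrightarrow>
    lam - (real n)\<^sup>2 = 2 / pi * ip (\<lambda>x. q x * ysol x) (sine (int n))" (is "_ = ?E")
proof
  assume "is_eigenvalue_L q lam"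
  then obtain y y' S where y: "y 0 = 0" "y pi = 0" "\<exists>x\<in>{0..pi}. y x \<noteq> 0"
      "\<And>x. x \<in> {0..pi} \<Longrightarrow> (y has_real_derivative y' x) (at x within {0..pi})"
      "continuous_on {0..pi} y'" "finite S"
      "\<And>x. x \<in> {0..pi} - S \<Longrightarrow> (y' has_real_derivative (q x - lam) * y x) (at x within {0..pi})"
    unfolding is_eigenvalue_L_def by blast
  have cy: "continuous_on {0..pi} y" using y(4) by (rule DERIV_continuous_on)
  then have yb: "bdd_meas y" by (rule bdd_meas_continuous)
  have coef: "(lam - (real m)\<^sup>2) * ip y (sine (int m)) = ip (\<lambda>x. q x * y x) (sine (int m))" for m :: nat
  proof -
    have "ip (\<lambda>x. (q x - lam) * y x) (sine (int m)) = - (real_of_int (int m))\<^sup>2 * ip y (sine (int m))"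
      by (rule sine_coeff_second_derivative[OF y(1,2,4-7)]) (auto intro!: bdd_meas_intros q yb)
    moreover have "ip (\<lambda>x. (q x - lam) * y x) (sine (int m))
        = ip (\<lambda>x. q x * y x) (sine (int m)) - ip (\<lambda>x. lam * y x) (sine (int m))"
      unfolding left_diff_distrib by (intro ip_diff bdd_meas_intros q yb)
    ultimately show ?thesis by (simp add: algebra_simps)
  qed
  \<comment> \<open>By \<open>ip_ysol_sine_n\<close> this factor makes the \<open>n\<close>-th
    coefficient of \<open>y - \<beta> * ysol\<close> vanish, as
    \<open>reduced_equation_unique\<close> requires.\<close>
  define \<beta> where "\<beta> = 2 / pi * ip y (sine (int n))"
  have ipw: "ip (\<lambda>x. y x - \<beta> * ysol x) h = ip y h - \<beta> * ip ysol h" if "bdd_meas h" for h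
    using that ip_diff[OF yb bdd_meas_mult[OF bdd_meas_const bdd_meas_ysol]] by simp
  have "y x - \<beta> * ysol x = 0" if "x \<in> {0..pi}" for x
  proof (rule reduced_equation_unique[OF _ _ _ that])
    show "continuous_on {0..pi} (\<lambda>x. y x - \<beta> * ysol x)"
      by (intro continuous_intros cy continuous_on_ysol)
    show "ip (\<lambda>x. y x - \<beta> * ysol x) (sine (int n)) = 0"
      unfolding ipw[OF bdd_meas_sine] by (simp add: ip_ysol_sine_n \<beta>_def)
    fix m :: nat assume m: "m \<ge> 1" "m \<noteq> n"
    have "ip (\<lambda>x. q x * (y x - \<beta> * ysol x)) (sine (int m))
        = ip (\<lambda>x. q x * y x) (sine (int m)) - \<beta> * ip (\<lambda>x. q x * ysol x) (sine (int m))"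
      by (simp add: ip_assoc ipw bdd_meas_qmult bdd_meas_sine)
    then show "(lam - (real m)\<^sup>2) * ip (\<lambda>x. y x - \<beta> * ysol x) (sine (int m))
        = ip (\<lambda>x. q x * (y x - \<beta> * ysol x)) (sine (int m))"
      using coef[of m] ip_ysol_sine[OF m]
      by (simp add: ipw bdd_meas_sine right_diff_distrib mult.left_commute)
  qed
  then have y_eq: "y x = \<beta> * ysol x" if "x \<in> {0..pi}" for x using that by force
  with y(3) have "\<beta> \<noteq> 0" by auto
  have "ip (\<lambda>x. q x * y x) (sine (int n)) = ip (\<lambda>x. \<beta> * (q x * ysol x)) (sine (int n))"
    by (rule ip_cong) (auto simp: y_eq)
  with coef[of n] have "(lam - (real n)\<^sup>2) * ip y (sine (int n)) = \<beta> * ip (\<lambda>x. q x * ysol x) (sine (int n))"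
    by simp
  moreover have "ip y (sine (int n)) = \<beta> * (pi / 2)" by (simp add: \<beta>_def)
  ultimately have "\<beta> * ((lam - (real n)\<^sup>2) * (pi / 2)) = \<beta> * ip (\<lambda>x. q x * ysol x) (sine (int n))"
    by (simp only: mult_ac)
  then have "(lam - (real n)\<^sup>2) * (pi / 2) = ip (\<lambda>x. q x * ysol x) (sine (int n))"
    using \<open>\<beta> \<noteq> 0\<close> by simp
  then show ?E by (simp flip: \<open>_ = ip (\<lambda>x. q x * ysol x) (sine (int n))\<close>)
next
  assume E: ?E
  have coef: "(lam - (real m)\<^sup>2) * ip ysol (sine (int m)) = ip (\<lambda>x. q x * ysol x) (sine (int m))"
    if "m \<ge> 1" for m :: nat
    using ip_ysol_sine[OF that] E by (cases "m = n") (simp_all add: ip_ysol_sine_n)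
  define f where "f x = (q x - lam) * ysol x" for x
  have bf: "bdd_meas f" unfolding f_def by (intro bdd_meas_intros q bdd_meas_ysol)
  have cf: "continuous (at x within {0..pi}) f" if "x \<in> {0..pi} - S" for x
    unfolding f_def using S(2)[OF that] continuous_on_ysol[of "{0..pi}"] that
    by (auto intro!: continuous_intros simp: continuous_on_eq_continuous_within)
  \<comment> \<open>\<open>ysol\<close> is so far only known to be continuous. The solution
    \<open>w\<close> of \<open>w'' = f\<close> has the required derivatives and boundary values, and
    equality of all sine coefficients identifies it with \<open>ysol\<close>.\<close>
  obtain w w' where w: "w 0 = 0" "w pi = 0"
    "\<And>x. x \<in> {0..pi} \<Longrightarrow> (w has_real_derivative w' x) (at x within {0..pi})"
    "continuous_on {0..pi} w'"
    "\<And>x. x \<in> {0..pi} - S \<Longrightarrow> (w' has_real_derivative f x) (at x within {0..pi})"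
    using dirichlet_solution_exists[OF bf S(1) cf] by blast
  have cw: "continuous_on {0..pi} w" using w(3) by (rule DERIV_continuous_on)
  have "w x - ysol x = 0" if "x \<in> {0..pi}" for x
  proof (rule sine_complete[OF _ _ that])
    show "continuous_on {0..pi} (\<lambda>x. w x - ysol x)"
      by (intro continuous_intros cw continuous_on_ysol)
    fix m :: nat assume m: "m \<ge> 1"
    have "ip f (sine (int m)) = - (real_of_int (int m))\<^sup>2 * ip w (sine (int m))"
      by (rule sine_coeff_second_derivative[OF w(1-4) S(1) w(5) bf])
    moreover have "ip f (sine (int m))
        = ip (\<lambda>x. q x * ysol x) (sine (int m)) - ip (\<lambda>x. lam * ysol x) (sine (int m))"
      unfolding f_def left_diff_distrib by (intro ip_diff bdd_meas_intros q bdd_meas_ysol)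
    ultimately have "(real m)\<^sup>2 * ip w (sine (int m)) = (real m)\<^sup>2 * ip ysol (sine (int m))"
      using coef[OF m] by (simp add: algebra_simps)
    then show "ip (\<lambda>x. w x - ysol x) (sine (int m)) = 0"
      using m by (simp add: ip_diff bdd_meas_sine bdd_meas_ysol bdd_meas_continuous[OF cw])
  qed
  then have eq: "w x = ysol x" if "x \<in> {0..pi}" for x using that by force
  have nz: "\<exists>x\<in>{0..pi}. w x \<noteq> 0"
  proof (rule ccontr)
    assume "\<not> ?thesis"
    then have "ip ysol (sine (int n)) = ip (\<lambda>x. 0) (sine (int n))"
      by (intro ip_cong) (auto simp: eq)
    then show False using ip_ysol_sine_n by (simp add: ip_def)
  qed
  have "\<forall>x\<in>{0..pi} - S. (w' has_real_derivative (q x - lam) * w x) (at x within {0..pi})"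
    using w(5) by (auto simp: f_def eq)
  then show "is_eigenvalue_L q lam"
    unfolding is_eigenvalue_L_def using w(1-4) nz S(1) by blast
qed

end

section \<open>The coefficients as sums over integer lists\<close>

lemma bij_betw_int_nonneg: "bij_betw int UNIV {0..}"
  by (rule bij_betwI[where g=nat]) auto

lemma bij_betw_int_nonpos: "bij_betw (\<lambda>l. - int l) UNIV {..0}"
  by (rule bij_betwI[where g="\<lambda>x. nat (- x)"]) auto

lemma UNIV_int_split: "(UNIV :: int set) = {0..} \<union> {..<0}"
  by auto

lemma summable_on_int_inverse_dist_squares:
  fixes lam :: real
  shows "(\<lambda>l::int. 1 / \<bar>lam - (of_int l)\<^sup>2\<bar>) summable_on UNIV" (is "?f summable_on _")
proof -
  have nat: "(\<lambda>l::nat. 1 / \<bar>lam - (real l)\<^sup>2\<bar>) summable_on UNIV"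
    by (rule norm_summable_imp_summable_on) (use summable_inverse_dist_squares in simp)
  have "?f summable_on {0..}" "?f summable_on {..0}"
    using nat summable_on_reindex_bij_betw[OF bij_betw_int_nonneg, of ?f]
      summable_on_reindex_bij_betw[OF bij_betw_int_nonpos, of ?f] by simp_all
  then have "?f summable_on {0..} \<union> {..<0}"
    by (intro summable_on_Un_disjoint) (auto intro: summable_on_subset)
  then show ?thesis unfolding UNIV_int_split .
qed

text \<open>Pairing \<open>l\<close> with \<open>- l\<close> counts the index \<open>0\<close>
  twice, which is harmless because \<open>f 0 = 0\<close>.\<close>

lemma has_sum_int_if_sums:
  fixes f :: "int \<Rightarrow> real"
  assumes f: "f summable_on UNIV" and "f 0 = 0" and s: "(\<lambda>l::nat. f (int l) + f (- int l)) sums s"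
  shows "(f has_sum s) UNIV"
proof -
  obtain A B where A: "(f has_sum A) {0..}" and B: "(f has_sum B) {..0}"
    using summable_on_subset[OF f] by (meson subset_UNIV summable_on_def)
  have "(\<lambda>l. f (int l)) sums A" "(\<lambda>l. f (- int l)) sums B"
    using A B has_sum_reindex_bij_betw[OF bij_betw_int_nonneg, of f]
      has_sum_reindex_bij_betw[OF bij_betw_int_nonpos, of f]
    by (auto intro: has_sum_imp_sums)
  then have "s = A + B" by (intro sums_unique2[OF s] sums_add)
  moreover have "(f has_sum B) {..<0}"
    using B by (rule has_sum_cong_neutral[THEN iffD1, rotated -1]) (use assms(2) in auto)
  then have "(f has_sum (A + B)) ({0..} \<union> {..<0})"
    by (intro has_sum_Un_disjoint A) auto
  ultimately show ?thesis unfolding UNIV_int_split by simp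
qed

section \<open>Cosine coefficients of the potential\<close>

lemma Ccoef_eq_ip: "Ccoef q k = 1 / pi * ip q (\<lambda>x. cos (of_int k * x))"
  by (simp add: Ccoef_def ip_def)

lemma Ccoef_minus: "Ccoef q (- k) = Ccoef q k"
  by (simp add: Ccoef_def)

lemma Ccoef_diff_commute: "Ccoef q (k - l) = Ccoef q (l - k)"
  using Ccoef_minus[of q "l - k"] by simp

text \<open>The product formula for sines turns the matrix entries of \<open>q\<close> in the sine
  basis into differences of cosine coefficients.\<close>

lemma ip_sine_q_sine:
  assumes "bdd_meas q"
  shows "2 / pi * ip (sine l) (\<lambda>x. q x * sine m x) = Ccoef q (l - m) - Ccoef q (l + m)"
proof -
  have b: "bdd_meas (\<lambda>x. cos (of_int k * x))" for k :: int
    by (intro bdd_meas_continuous continuous_intros)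
  have "ip (sine l) (\<lambda>x. q x * sine m x)
      = ip (\<lambda>x. 1 / 2 * (cos (of_int (l - m) * x) - cos (of_int (l + m) * x))) q"
    unfolding ip_def by (rule integral_cong) (use sine_mult[of l _ m] in \<open>auto simp: mult_ac\<close>)
  also have "\<dots> = 1 / 2 * (ip (\<lambda>x. cos (of_int (l - m) * x)) q - ip (\<lambda>x. cos (of_int (l + m) * x)) q)"
    unfolding ip_scale ip_diff[OF b b assms] ..
  finally show ?thesis by (simp add: Ccoef_eq_ip ip_commute[of q] right_diff_distrib)
qed

lemma abs_Ccoef_le:
  assumes "bdd_meas q" "\<And>x. x \<in> {0..pi} \<Longrightarrow> \<bar>q x\<bar> \<le> M"
  shows "\<bar>Ccoef q k\<bar> \<le> M"
proof -
  have "\<bar>ip q (\<lambda>x. cos (of_int k * x))\<bar> \<le> M * 1 * pi"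
    by (intro ip_bound assms) (auto intro!: bdd_meas_continuous continuous_intros)
  then show ?thesis by (simp add: Ccoef_eq_ip abs_mult field_simps)
qed

text \<open>The walks start at an arbitrary \<open>m\<close> instead of \<open>n\<close>, so that removing the first step of
  a walk gives a recursion matching the one for the Neumann series.\<close>

fun admissible :: "nat \<Rightarrow> int \<Rightarrow> int list \<Rightarrow> bool" where
  "admissible n m [] \<longleftrightarrow> True"
| "admissible n m (x # xs) \<longleftrightarrow> m + x \<noteq> int n \<and> m + x \<noteq> - int n \<and> admissible n (m + x) xs"

definition paths :: "nat \<Rightarrow> int \<Rightarrow> nat \<Rightarrow> int list set" where
  "paths n m k = {ns. length ns = k \<and> admissible n m ns}"

text \<open>For \<open>C = Ccoef q\<close> the value at the empty walk is the \<open>m\<close>-th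
  sine coefficient of \<open>src 0\<close>.\<close>

fun path_term :: "(int \<Rightarrow> real) \<Rightarrow> nat \<Rightarrow> real \<Rightarrow> int \<Rightarrow> int list \<Rightarrow> real" where
  "path_term C n lam m [] = C (m - int n) - C (m + int n)"
| "path_term C n lam m (x # xs) = C x / (lam - (of_int (m + x))\<^sup>2) * path_term C n lam (m + x) xs"

lemma admissible_iff:
  "admissible n m ns \<longleftrightarrow>
    (\<forall>j<length ns. m + sum_list (take (Suc j) ns) \<noteq> int n \<and> m + sum_list (take (Suc j) ns) \<noteq> - int n)"
  by (induction ns arbitrary: m) (auto simp: All_less_Suc2 add.assoc)

text \<open>From the start \<open>n\<close>, the partial sums \<open>0\<close> and
  \<open>- 2 * n\<close> lead exactly to the forbidden positions \<open>n\<close> and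
  \<open>- n\<close>.\<close>

lemma paths_eq_idx_set: "paths n (int n) k = idx_set n k"
proof -
  have "{1..k} = Suc ` {..<k}" by (simp add: lessThan_atLeast0 image_Suc_atLeastLessThan atLeastLessThanSuc_atLeastAtMost)
  then have "(\<forall>j\<in>{1..k}. P j) \<longleftrightarrow> (\<forall>j<k. P (Suc j))" for P by auto
  moreover have "int n + s = - int n \<longleftrightarrow> s = - 2 * int n" for s by auto
  ultimately show ?thesis
    unfolding paths_def idx_set_def admissible_iff by auto
qed

lemma path_term_eq:
  "path_term C n lam m ns =
    (\<Prod>j\<leftarrow>ns. C j) * (C (m + sum_list ns - int n) - C (m + sum_list ns + int n)) /
    (\<Prod>j<length ns. (lam - (of_int (m + sum_list (take (Suc j) ns)))\<^sup>2))"
  by (induction ns arbitrary: m) (auto simp: prod.lessThan_Suc_shift add.assoc simp del: prod.lessThan_Suc)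

lemma path_term_eq_a_term: "path_term C n lam (int n) ns = a_term C n lam ns"
proof -
  have "(\<Prod>j<length ns. (lam - (of_int (int n + sum_list (take (Suc j) ns)))\<^sup>2))
      = (\<Prod>j=1..length ns. (lam - (of_int (int n + sum_list (take j ns)))\<^sup>2))"
    by (rule prod.reindex_bij_witness[of _ "\<lambda>j. j - 1" Suc]) auto
  then show ?thesis by (simp add: path_term_eq a_term_def algebra_simps)
qed

lemma paths_0: "paths n m 0 = {[]}"
  by (auto simp: paths_def)

lemma bij_betw_Cons_paths:
  "bij_betw (\<lambda>(x, xs). x # xs)
    (SIGMA x:{x. m + x \<noteq> int n \<and> m + x \<noteq> - int n}. paths n (m + x) k) (paths n m (Suc k))"
  by (rule bij_betwI[where g="\<lambda>ns. (hd ns, tl ns)"]) (auto simp: paths_def length_Suc_conv)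

text \<open>Induction on the length by splitting off the first step. The bound must be uniform in
  \<open>m\<close>, because that step moves the start to \<open>m + x\<close>.\<close>

lemma abs_path_term_has_sum:
  assumes C: "\<And>j. \<bar>C j\<bar> \<le> M"
  shows "\<exists>K\<ge>0. \<forall>m. \<exists>s. s \<le> K \<and> ((\<lambda>ns. \<bar>path_term C n lam m ns\<bar>) has_sum s) (paths n m k)"
proof (induction k)
  case 0
  have "\<bar>path_term C n lam m []\<bar> \<le> 2 * M" for m
    using C[of "m - int n"] C[of "m + int n"] by simp
  moreover have "0 \<le> 2 * M" using C[of 0] by simp
  moreover have "((\<lambda>ns. \<bar>path_term C n lam m ns\<bar>) has_sum \<bar>path_term C n lam m []\<bar>) (paths n m 0)" for m
    unfolding paths_0 by (rule has_sum_finiteI) auto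
  ultimately show ?case
    by (intro exI[of _ "2 * M"] conjI allI exI[of _ "\<bar>path_term C n lam _ []\<bar>"])
next
  case (Suc k)
  have M: "0 \<le> M" using C[of 0] by simp
  obtain K where K: "K \<ge> 0"
      "\<forall>m. \<exists>s. s \<le> K \<and> ((\<lambda>ns. \<bar>path_term C n lam m ns\<bar>) has_sum s) (paths n m k)"
    using Suc by (elim exE conjE)
  then obtain s where "\<forall>m. s m \<le> K \<and> ((\<lambda>ns. \<bar>path_term C n lam m ns\<bar>) has_sum s m) (paths n m k)"
    using choice[OF K(2)] by (elim exE)
  then have s: "\<And>m. s m \<le> K" "\<And>m. ((\<lambda>ns. \<bar>path_term C n lam m ns\<bar>) has_sum s m) (paths n m k)"
    by (simp_all only:)
  have s0: "0 \<le> s m" for m using s(2)[of m] by (rule has_sum_nonneg) auto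
  define R where "R l = 1 / \<bar>lam - (of_int l)\<^sup>2\<bar>" for l :: int
  have R: "R summable_on UNIV" unfolding R_def by (rule summable_on_int_inverse_dist_squares)
  have R0: "R l \<ge> 0" for l by (simp add: R_def)
  show ?case
  \<comment> \<open>The first step brings a factor \<open>\<bar>C x\<bar> \<le> M\<close> and the
    remaining walk at most \<open>K\<close>; the sum of \<open>R (m + x)\<close> over all integers
    \<open>x\<close> does not depend on \<open>m\<close>.\<close>
  proof (rule exI[of _ "M * K * infsum R UNIV"], intro conjI allI)
    show "0 \<le> M * K * infsum R UNIV" by (intro mult_nonneg_nonneg M K(1) infsum_nonneg R0)
    fix m
    let ?A = "{x. m + x \<noteq> int n \<and> m + x \<noteq> - int n}"
    define g where "g x = \<bar>C x\<bar> * R (m + x) * s (m + x)" for x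
    have bij: "bij_betw (\<lambda>x. m + x) UNIV UNIV" by (rule bij_betwI[where g="\<lambda>x. x - m"]) auto
    have dom: "(\<lambda>x. M * K * R (m + x)) summable_on UNIV"
      by (intro summable_on_cmult_right) (use summable_on_reindex_bij_betw[OF bij, of R] R in simp)
    have g_le: "g x \<le> M * K * R (m + x)" for x
    proof -
      have "g x = \<bar>C x\<bar> * s (m + x) * R (m + x)" by (simp add: g_def)
      also have "\<dots> \<le> M * K * R (m + x)" by (intro mult_right_mono mult_mono C s s0 R0 M)
      finally show ?thesis .
    qed
    have g0: "0 \<le> g x" for x by (simp add: g_def R0 s0)
    have gA: "g summable_on ?A"
      by (rule summable_on_comparison_test[OF summable_on_subset[OF dom]]) (auto simp: g_le g0)
    define f where "f = (\<lambda>(x, xs). \<bar>path_term C n lam m (x # xs)\<bar>)"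
    have inner: "((\<lambda>xs. f (x, xs)) has_sum g x) (paths n (m + x) k)" for x
    proof -
      have "((\<lambda>xs. (\<bar>C x\<bar> * R (m + x)) * \<bar>path_term C n lam (m + x) xs\<bar>) has_sum g x) (paths n (m + x) k)"
        unfolding g_def by (rule has_sum_cmult_right[OF s(2)])
      then show ?thesis by (simp add: f_def abs_mult R_def)
    qed
    have "f summable_on (SIGMA x:?A. paths n (m + x) k)"
      by (rule summable_on_SigmaI[where f=f and g=g]) (use inner gA in \<open>auto simp: f_def\<close>)
    then have "(f has_sum infsum g ?A) (SIGMA x:?A. paths n (m + x) k)"
      by (rule has_sum_SigmaI[where f=f and g=g, rotated 2]) (use inner gA in auto)
    then have "((\<lambda>ns. \<bar>path_term C n lam m ns\<bar>) has_sum infsum g ?A) (paths n m (Suc k))"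
      using has_sum_reindex_bij_betw[OF bij_betw_Cons_paths, of "\<lambda>ns. \<bar>path_term C n lam m ns\<bar>"]
      by (simp add: f_def case_prod_unfold)
    moreover have "infsum g ?A \<le> (\<Sum>\<^sub>\<infinity>x. M * K * R (m + x))"
      by (rule infsum_mono_neutral[OF gA dom]) (auto simp: g_le K(1) M R0)
    moreover have "(\<Sum>\<^sub>\<infinity>x. M * K * R (m + x)) = M * K * infsum R UNIV"
      unfolding infsum_reindex_bij_betw[OF bij, of "\<lambda>x. M * K * R x"] by (rule infsum_cmult_right')
    ultimately show "\<exists>s\<le>M * K * infsum R UNIV.
        ((\<lambda>ns. \<bar>path_term C n lam m ns\<bar>) has_sum s) (paths n m (Suc k))"
      by (intro exI[of _ "infsum g ?A"]) simp
  qed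
qed

lemma path_term_summable:
  assumes "\<And>j. \<bar>C j\<bar> \<le> M"
  shows "path_term C n lam m summable_on paths n m k"
proof -
  obtain s where "((\<lambda>ns. \<bar>path_term C n lam m ns\<bar>) has_sum s) (paths n m k)"
    using abs_path_term_has_sum[of C M n lam k] assms by blast
  then have "(\<lambda>ns. norm (path_term C n lam m ns)) summable_on paths n m k"
    by (auto simp: summable_on_def)
  then show ?thesis by (rule abs_summable_summable)
qed

section \<open>The Neumann series as a sum over walks\<close>

context gapped_dirichlet begin

definition src_coeff :: "nat \<Rightarrow> int \<Rightarrow> real" where
  "src_coeff k m = 2 / pi * ip (src k) (sine m)"

lemma src_coeff_minus: "src_coeff k (- m) = - src_coeff k m"
  by (simp add: src_coeff_def ip_def)

lemma src_coeff_0: "src_coeff 0 m = Ccoef q (m - int n) - Ccoef q (m + int n)"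
  using ip_sine_q_sine[OF q, of m "int n"]
  by (simp add: src_coeff_def ip_commute[of _ "sine m"])

lemma abs_src_coeff_le: "\<bar>src_coeff k m\<bar> \<le> sqrt (2 / pi * ip (src k) (src k))"
proof -
  have "\<bar>src_coeff k m\<bar> = \<bar>src_coeff k (int (nat \<bar>m\<bar>))\<bar>"
    by (cases "m \<ge> 0") (auto simp: src_coeff_minus)
  also have "\<dots> \<le> sqrt (2 / pi * ip (src k) (src k))"
    unfolding src_coeff_def by (rule abs_coeff_le[OF bdd_meas_src])
  finally show ?thesis .
qed

text \<open>Move \<open>q\<close> to the other factor of the inner product and integrate the sine
  series of \<open>red_res (src k)\<close> termwise.\<close>

lemma src_coeff_Suc_sums:
  "(\<lambda>l::nat. (if l = n then 0 else src_coeff k (int l) / (lam - (real l)\<^sup>2))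
      * (Ccoef q (int l - m) - Ccoef q (int l + m))) sums src_coeff (Suc k) m"
proof -
  have "(\<lambda>l. ip (\<lambda>x. gcoef (src k) l * sine (int l) x) (\<lambda>x. q x * sine m x))
      sums ip (red_res (src k)) (\<lambda>x. q x * sine m x)"
    unfolding red_res_def[abs_def]
    by (rule ip_series[OF _ abs_gcoef_sine_le summable_gcoef[OF bdd_meas_src]])
      (auto intro!: bdd_meas_intros q)
  then have "(\<lambda>l. 2 / pi * ip (\<lambda>x. gcoef (src k) l * sine (int l) x) (\<lambda>x. q x * sine m x))
      sums (2 / pi * ip (red_res (src k)) (\<lambda>x. q x * sine m x))"
    by (rule sums_mult)
  moreover have "2 / pi * ip (\<lambda>x. gcoef (src k) l * sine (int l) x) (\<lambda>x. q x * sine m x)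
      = gcoef (src k) l * (Ccoef q (int l - m) - Ccoef q (int l + m))" for l
    unfolding ip_sine_q_sine[OF q, symmetric] ip_scale by (rule mult.left_commute)
  moreover have "src_coeff (Suc k) m = 2 / pi * ip (red_res (src k)) (\<lambda>x. q x * sine m x)"
    by (simp add: src_coeff_def ip_assoc)
  moreover have "gcoef (src k) l = (if l = n then 0 else src_coeff k (int l) / (lam - (real l)\<^sup>2))" for l
    by (simp add: gcoef_def src_coeff_def)
  ultimately show ?thesis by simp
qed

text \<open>Since \<open>src_coeff k\<close> is odd and \<open>Ccoef q\<close> is even, the
  difference of cosine coefficients at the mode \<open>l\<close> splits into one term at
  \<open>l\<close> and one at \<open>- l\<close>.\<close>

lemma src_coeff_Suc_has_sum:
  "((\<lambda>x. Ccoef q x / (lam - (of_int (m + x))\<^sup>2) * src_coeff k (m + x)) has_sum src_coeff (Suc k) m)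
    {x. m + x \<noteq> int n \<and> m + x \<noteq> - int n}"
proof -
  \<comment> \<open>Here \<open>l\<close> is the position reached by the step
    \<open>x = l - m\<close>; the value 0 at \<open>n\<close> and \<open>- n\<close> lets the sum
    run over all integers.\<close>
  define f where "f l = (if l = int n \<or> l = - int n then 0
      else src_coeff k l / (lam - (of_int l)\<^sup>2) * Ccoef q (m - l))" for l :: int
  let ?K = "sqrt (2 / pi * ip (src k) (src k)) * M"
  have "(\<lambda>l. norm (f l)) summable_on UNIV"
  proof (rule Infinite_Sum.abs_summable_on_comparison_test')
    show "(\<lambda>l::int. ?K * (1 / \<bar>lam - (of_int l)\<^sup>2\<bar>)) summable_on UNIV"
      by (intro summable_on_cmult_right summable_on_int_inverse_dist_squares)
    fix l
    have "\<bar>src_coeff k l\<bar> * \<bar>Ccoef q (m - l)\<bar> \<le> ?K"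
      by (intro mult_mono abs_src_coeff_le abs_Ccoef_le q q_le) (auto simp: ip_nonneg bdd_meas_src)
    then have "\<bar>src_coeff k l\<bar> * \<bar>Ccoef q (m - l)\<bar> * (1 / \<bar>lam - (of_int l)\<^sup>2\<bar>)
        \<le> ?K * (1 / \<bar>lam - (of_int l)\<^sup>2\<bar>)"
      by (intro mult_right_mono) auto
    moreover have "norm (f l) \<le> \<bar>src_coeff k l\<bar> * \<bar>Ccoef q (m - l)\<bar> * (1 / \<bar>lam - (of_int l)\<^sup>2\<bar>)"
      by (simp add: f_def abs_mult)
    ultimately show "norm (f l) \<le> ?K * (1 / \<bar>lam - (of_int l)\<^sup>2\<bar>)" by linarith
  qed
  then have "f summable_on UNIV" by (rule abs_summable_summable)
  moreover have "f 0 = 0" by (simp add: f_def src_coeff_def ip_def)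
  moreover have "f (int l) + f (- int l) = (if l = n then 0 else src_coeff k (int l) / (lam - (real l)\<^sup>2))
      * (Ccoef q (int l - m) - Ccoef q (int l + m))" for l
    by (auto simp: f_def src_coeff_minus Ccoef_diff_commute[of q "int l" m] right_diff_distrib add.commute)
  then have "(\<lambda>l. f (int l) + f (- int l)) sums src_coeff (Suc k) m"
    using src_coeff_Suc_sums by simp
  ultimately have "(f has_sum src_coeff (Suc k) m) UNIV"
    by (rule has_sum_int_if_sums)
  moreover have "bij_betw (\<lambda>x. m + x) UNIV UNIV" by (rule bij_betwI[where g="\<lambda>x. x - m"]) auto
  ultimately have "((\<lambda>x. f (m + x)) has_sum src_coeff (Suc k) m) UNIV"
    using has_sum_reindex_bij_betw by blast
  then show ?thesis
    by (rule has_sum_cong_neutral[THEN iffD1, rotated -1])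
      (auto simp: f_def Ccoef_minus)
qed

text \<open>Both sides obey the recursion that splits off the first step; summability over all walks
  allows the sum to be taken first over the later steps.\<close>

lemma path_term_has_sum:
  "(path_term (Ccoef q) n lam m has_sum src_coeff k m) (paths n m k)"
proof (induction k arbitrary: m)
  case 0
  show ?case unfolding paths_0 by (rule has_sum_finiteI) (auto simp: src_coeff_0)
next
  case (Suc k)
  let ?A = "{x. m + x \<noteq> int n \<and> m + x \<noteq> - int n}"
  have "path_term (Ccoef q) n lam m summable_on paths n m (Suc k)"
    by (rule path_term_summable[OF abs_Ccoef_le[OF q q_le]])
  then have sum: "(\<lambda>p. path_term (Ccoef q) n lam m (case p of (x, xs) \<Rightarrow> x # xs))
      summable_on (SIGMA x:?A. paths n (m + x) k)"
    using summable_on_reindex_bij_betw[OF bij_betw_Cons_paths, of "path_term (Ccoef q) n lam m"] by blast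
  have "((\<lambda>p. path_term (Ccoef q) n lam m (case p of (x, xs) \<Rightarrow> x # xs)) has_sum src_coeff (Suc k) m)
      (SIGMA x:?A. paths n (m + x) k)"
    by (rule has_sum_SigmaI[OF _ src_coeff_Suc_has_sum sum])
      (unfold prod.case path_term.simps, intro has_sum_cmult_right Suc)
  then show ?case
    using has_sum_reindex_bij_betw[OF bij_betw_Cons_paths, of "path_term (Ccoef q) n lam m"] by blast
qed

lemma a_coef_eq: "a_coef (Ccoef q) n k lam = src_coeff k (int n)"
proof -
  have "a_coef (Ccoef q) n k lam = infsum (path_term (Ccoef q) n lam (int n)) (paths n (int n) k)"
    unfolding a_coef_def paths_eq_idx_set by (intro infsum_cong) (simp add: path_term_eq_a_term)
  then show ?thesis using infsumI[OF path_term_has_sum] by simp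
qed

text \<open>The term with index \<open>0\<close> gives
  \<open>Ccoef q 0 - Ccoef q (2 * int n)\<close> and the later ones give the \<open>a_k\<close>; for
  general \<open>q\<close> the mean value \<open>Ccoef q 0\<close> is still present.\<close>

theorem eigenvalue_iff:
  assumes "finite S" "\<And>x. x \<in> {0..pi} - S \<Longrightarrow> continuous (at x within {0..pi}) q"
  shows "is_eigenvalue_L q lam \<longleftrightarrow>
    lam - (real n)\<^sup>2 - Ccoef q 0 + Ccoef q (2 * int n) - (\<Sum>k. a_coef (Ccoef q) n (Suc k) lam) = 0"
proof -
  have "(\<lambda>k. src_coeff k (int n)) sums (2 / pi * ip (\<lambda>x. q x * ysol x) (sine (int n)))"
    unfolding src_coeff_def by (intro sums_mult ip_q_ysol_sums bdd_meas_sine)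
  then have "(\<lambda>k. src_coeff (Suc k) (int n))
      sums (2 / pi * ip (\<lambda>x. q x * ysol x) (sine (int n)) - src_coeff 0 (int n))"
    by (subst sums_Suc_iff) simp
  then have "(\<Sum>k. a_coef (Ccoef q) n (Suc k) lam)
      = 2 / pi * ip (\<lambda>x. q x * ysol x) (sine (int n)) - (Ccoef q 0 - Ccoef q (2 * int n))"
    by (simp add: a_coef_eq sums_iff src_coeff_0)
  moreover have "is_eigenvalue_L q lam \<longleftrightarrow>
      lam - (real n)\<^sup>2 = 2 / pi * ip (\<lambda>x. q x * ysol x) (sine (int n))"
    by (rule eigenvalue_iff_ip[OF assms])
  ultimately show ?thesis by linarith
qed

end

section \<open>The step potential\<close>

lemma bdd_meas_step_pot: "bdd_meas (step_pot a b c)"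
proof (rule bdd_measI)
  show "step_pot a b c \<in> borel_measurable (lebesgue_on {0..pi})"
    by (intro measurable_restrict_space1 measurable_completion) (simp add: step_pot_def[abs_def])
  show "\<bar>step_pot a b c x\<bar> \<le> max \<bar>a\<bar> \<bar>b\<bar>" for x by (simp add: step_pot_def)
qed

lemma continuous_step_pot:
  assumes "x \<noteq> c"
  shows "continuous (at x within S) (step_pot a b c)"
proof -
  consider "x < c" | "c < x" using assms by linarith
  then have "isCont (step_pot a b c) x"
  proof cases
    case 1
    then have "\<forall>\<^sub>F y in nhds x. y \<in> {..<c}" by (intro eventually_nhds_in_open) auto
    then have "\<forall>\<^sub>F y in nhds x. step_pot a b c y = a" by eventually_elim (simp add: step_pot_def)
    then have "isCont (step_pot a b c) x \<longleftrightarrow> isCont (\<lambda>_. a) x" by (rule isCont_cong)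
    then show ?thesis by simp
  next
    case 2
    then have "\<forall>\<^sub>F y in nhds x. y \<in> {c<..}" by (intro eventually_nhds_in_open) auto
    then have "\<forall>\<^sub>F y in nhds x. step_pot a b c y = b" by eventually_elim (simp add: step_pot_def)
    then have "isCont (step_pot a b c) x \<longleftrightarrow> isCont (\<lambda>_. b) x" by (rule isCont_cong)
    then show ?thesis by simp
  qed
  then show ?thesis by (rule continuous_at_imp_continuous_at_within)
qed

text \<open>Through this formula the condition \<open>a * c + b * (pi - c) = 0\<close> removes the
  mean value from the equation.\<close>

lemma Ccoef_step_pot_0:
  assumes "0 < c" "c < pi"
  shows "Ccoef (step_pot a b c) 0 = (a * c + b * (pi - c)) / pi"
proof -
  have "(step_pot a b c has_integral a * c) {0..c}"
    by (rule has_integral_eq[of _ "\<lambda>x. a"])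
      (use has_integral_const_real[of a 0 c] assms in \<open>auto simp: step_pot_def mult.commute\<close>)
  moreover have "(step_pot a b c has_integral b * (pi - c)) {c..pi}"
    by (rule has_integral_spike_finite[of "{c}" _ _ "\<lambda>x. b"])
      (use has_integral_const_real[of b c pi] assms in \<open>auto simp: step_pot_def mult.commute\<close>)
  ultimately have "(step_pot a b c has_integral a * c + b * (pi - c)) {0..pi}"
    using assms by (intro has_integral_combine[of 0 c pi]) auto
  then show ?thesis by (simp add: Ccoef_def integral_unique)
qed

theorem theorem3:
  fixes a b c lam :: real and n :: nat
  assumes "a < b" and "0 < c" and "c < pi" and "a * c + b * (pi - c) = 0"
    and "n \<ge> 1"
    and "n > 1 \<Longrightarrow> max \<bar>a\<bar> b < (2 * real n - 1) / 2"
    and "n = 1 \<Longrightarrow> max \<bar>a\<bar> b \<le> 1 / 2"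
    and "lam \<in> {real n ^ 2 - max \<bar>a\<bar> b .. real n ^ 2 + max \<bar>a\<bar> b}"
  shows "is_eigenvalue_L (step_pot a b c) lam \<longleftrightarrow>
    lam - real n ^ 2 + Ccoef (step_pot a b c) (2 * int n)
      - (\<Sum>k. a_coef (Ccoef (step_pot a b c)) n (Suc k) lam) = 0"
proof -
  define M where "M = max \<bar>a\<bar> b"
  \<comment> \<open>For \<open>n > 1\<close> the nearest other square is \<open>(n - 1)^2\<close>,
    at distance \<open>2 * n - 1\<close>; for \<open>n = 1\<close> the nearest \<open>m^2\<close>
    with \<open>m \<ge> 1\<close> is 4, at distance 3. Since \<open>lam\<close> may lie
    \<open>M\<close> away from \<open>n^2\<close>, \<open>M\<close> is subtracted.\<close>
  define \<delta> where "\<delta> = (if n = 1 then 3 else 2 * real n - 1) - M"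
  \<comment> \<open>With \<open>b \<le> 0\<close> also \<open>a < 0\<close>, and the mean value
    would be negative. Positivity makes \<open>M\<close> a bound for \<bar>b\<bar>.\<close>
  have "b > 0"
  proof (rule ccontr)
    assume "\<not> b > 0"
    then have "b * (pi - c) \<le> 0" "a * c < 0"
      using assms(1-3) by (auto intro: mult_nonpos_nonneg mult_neg_pos)
    then show False using assms(4) by simp
  qed
  then have q_le: "\<bar>step_pot a b c x\<bar> \<le> M" for x by (simp add: step_pot_def M_def)
  have M_less: "M < \<delta>"
    using assms(5-7) unfolding M_def[symmetric] \<delta>_def by (cases "n = 1") auto
  have lam: "(real n)\<^sup>2 - M \<le> lam" "lam \<le> (real n)\<^sup>2 + M" using assms(8) by (auto simp: M_def)
  have gap: "\<delta> \<le> \<bar>lam - (real m)\<^sup>2\<bar>" if "m \<ge> 1" "m \<noteq> n" for m :: nat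
  proof (cases "m < n")
    case True
    then have "real m \<le> real n - 1" by linarith
    then have "(real m)\<^sup>2 \<le> (real n - 1)\<^sup>2" by (intro power_mono) auto
    then show ?thesis using lam True that by (auto simp: \<delta>_def power2_eq_square algebra_simps)
  next
    case False
    then have "real n + 1 \<le> real m" using that by linarith
    then have "(real n + 1)\<^sup>2 \<le> (real m)\<^sup>2" by (intro power_mono) auto
    then show ?thesis using lam by (auto simp: \<delta>_def power2_eq_square algebra_simps)
  qed
  interpret gapped_dirichlet "step_pot a b c" M \<delta> lam n
    by unfold_locales (use bdd_meas_step_pot q_le assms(5) M_less gap in auto)
  have "Ccoef (step_pot a b c) 0 = 0"
    using Ccoef_step_pot_0[OF assms(2,3)] assms(4) by simp
  then show ?thesis
    using eigenvalue_iff[of "{c}"] continuous_step_pot by simp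
qed

end
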